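(* The log-likelihood $$\ell(\theta,\alpha^{2};\mathbf Z)=-\frac N2\log(2\pi)-\frac N2\log\alpha^{2}-\frac12\log|\Gamma_H|-\frac{1}{2\alpha^{2}}(\mathbf Z-\theta\mathbf T)^{\top}\Gamma_H^{-1}(\mathbf Z-\theta\mathbf T)$$ admits the unique global maximiser $$\widehat\theta=\frac{\mathbf T^{\top}\Gamma_H^{-1}\mathbf Z}{\mathbf T^{\top}\Gamma_H^{-1}\mathbf T},\qquad \widehat\alpha^{\,2}=\frac1N\left(\mathbf Z^{\top}\Gamma_H^{-1}\mathbf Z-\frac{(\mathbf T^{\top}\Gamma_H^{-1}\mathbf Z)^{2}}{\mathbf T^{\top}\Gamma_H^{-1}\mathbf T}\right)$$ on $\mathbb R\times(0,\infty)$, almost surely.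
   Context: The mesh $h>0$ and the number of components $m\in\mathbb N$ are fixed and known, and the Hurst parameters $H_1,\dots,H_m\in(1/2,1)$ are known. Let $B^{H_1},\dots,B^{H_m}$ be independent fractional Brownian motions, i.e. independent centred continuous-time Gaussian processes with $B^{H_r}(0)=0$ and $\mathbb E[B^{H_r}(t)B^{H_r}(s)]=\frac12(t^{2H_r}+s^{2H_r}-|t-s|^{2H_r})$ for $s,t\ge0$. The drift $\theta\in\mathbb R$ and the scale $\alpha>0$ are unknown. Set $Z(t)=\theta t+\alpha\sum_{r=1}^m B^{H_r}(t)$ for $t\ge0$, observed at the $N$ times $t_k=kh$, $k=1,\dots,N$, and put $\mathbf T=(t_1,\dots,t_N)^\top$, $\mathbf Z=(Z(t_1),\dots,Z(t_N))^\top$. Let $\Gamma_H=\sum_{r=1}^m\Gamma_{H_r}$ be the $N\times N$ matrix with $(\Gamma_{H_r})_{ij}=\frac12(t_i^{2H_r}+t_j^{2H_r}-|t_i-t_j|^{2H_r})$, $i,j=1,\dots,N$; it is symmetric positive definite, $|\Gamma_H|$ denotes its determinant, and $\mathbf Z\sim\mathcal N(\theta\mathbf T,\alpha^2\Gamma_H)$. In the log-likelihood, $(\theta,\alpha^2)$ is the free argument; "almost surely" refers to the law of $\mathbf Z$ under the true parameters.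
   Formalization: The number of observations N is assumed to be at least 2: for N = 1 the formula gives a scale estimate equal to 0, outside (0,∞), and the log-likelihood is unbounded, so no maximiser exists. The number of components m is taken to be at least 1. *)

theory Defs
  imports "HOL-Probability.Probability"
begin

text \<open>Degenerate (almost surely constant) variables count as Gaussian.\<close>
definition gaussian_rv :: "'a measure \<Rightarrow> ('a \<Rightarrow> real) \<Rightarrow> bool" where
  "gaussian_rv M Y \<longleftrightarrow> Y \<in> borel_measurable M \<and>
     ((\<exists>\<mu> \<sigma>. 0 < \<sigma> \<and> distributed M lborel Y (normal_density \<mu> \<sigma>)) \<or>
      (\<exists>\<mu>. AE \<omega> in M. Y \<omega> = \<mu>))"

text \<open>Joint Gaussianity of the finite-dimensional distributions is expressed, as usual, by all
  finite linear combinations being Gaussian.\<close>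
definition gaussian_process_on :: "'a measure \<Rightarrow> 't set \<Rightarrow> ('t \<Rightarrow> 'a \<Rightarrow> real) \<Rightarrow> bool" where
  "gaussian_process_on M I X \<longleftrightarrow>
     (\<forall>F c. finite F \<and> F \<subseteq> I \<longrightarrow> gaussian_rv M (\<lambda>\<omega>. \<Sum>t\<in>F. c t * X t \<omega>))"

definition fbm_cov :: "real \<Rightarrow> real \<Rightarrow> real \<Rightarrow> real" where
  "fbm_cov H t s = (t powr (2 * H) + s powr (2 * H) - \<bar>t - s\<bar> powr (2 * H)) / 2"

text \<open>The time set is the half-line; values of the process at negative times are irrelevant.\<close>
definition fractional_brownian_motion :: "'a measure \<Rightarrow> real \<Rightarrow> (real \<Rightarrow> 'a \<Rightarrow> real) \<Rightarrow> bool" where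
  "fractional_brownian_motion M H B \<longleftrightarrow>
     gaussian_process_on M {0..} B \<and>
     (AE \<omega> in M. B 0 \<omega> = 0) \<and>
     (\<forall>t\<ge>0. integral\<^sup>L M (B t) = 0) \<and>
     (\<forall>t\<ge>0. \<forall>s\<ge>0. integral\<^sup>L M (\<lambda>\<omega>. B t \<omega> * B s \<omega>) = fbm_cov H t s)"

text \<open>Independence of whole processes: the path-valued maps on the half-line are independent
  with respect to the product sigma-algebra.\<close>
definition independent_processes ::
    "'a measure \<Rightarrow> 'r set \<Rightarrow> ('r \<Rightarrow> real \<Rightarrow> 'a \<Rightarrow> real) \<Rightarrow> bool" where
  "independent_processes M R B \<longleftrightarrow>
     prob_space.indep_vars M (\<lambda>_. PiM {0..} (\<lambda>_. borel))
       (\<lambda>r \<omega>. restrict (\<lambda>t. B r t \<omega>) {0..}) R"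

definition mixed_fbm_drift ::
    "nat \<Rightarrow> (nat \<Rightarrow> real \<Rightarrow> 'a \<Rightarrow> real) \<Rightarrow> real \<Rightarrow> real \<Rightarrow> real \<Rightarrow> 'a \<Rightarrow> real" where
  "mixed_fbm_drift m B \<theta> \<alpha> t \<omega> = \<theta> * t + \<alpha> * (\<Sum>r=1..m. B r t \<omega>)"

text \<open>In what follows the coordinates of \<open>real ^ 'n\<close> are numbered by a bijection \<open>k\<close> from \<open>'n\<close>
  onto \<open>{1..CARD('n)}\<close>, so the coordinate \<open>i\<close> belongs to the time \<open>k i * h\<close>.\<close>
definition obs_times :: "('n::finite \<Rightarrow> nat) \<Rightarrow> real \<Rightarrow> real ^ 'n" where
  "obs_times k h = (\<chi> i. real (k i) * h)"

definition obs_vector :: "real ^ 'n \<Rightarrow> (real \<Rightarrow> 'a \<Rightarrow> real) \<Rightarrow> 'a \<Rightarrow> real ^ 'n::finite" where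
  "obs_vector T Z \<omega> = (\<chi> i. Z (T $ i) \<omega>)"

definition Gamma_H :: "nat \<Rightarrow> (nat \<Rightarrow> real) \<Rightarrow> real ^ 'n \<Rightarrow> real ^ 'n ^ 'n::finite" where
  "Gamma_H m H T = (\<Sum>r=1..m. \<chi> i j. fbm_cov (H r) (T $ i) (T $ j))"

text \<open>The second component of the parameter pair is the squared scale.\<close>
definition log_likelihood ::
    "real ^ 'n ^ 'n \<Rightarrow> real ^ 'n \<Rightarrow> real ^ 'n \<Rightarrow> real \<times> real \<Rightarrow> real" where
  "log_likelihood \<Gamma> T z = (\<lambda>(\<theta>, a).
     - (real CARD('n::finite) / 2) * ln (2 * pi) - (real CARD('n) / 2) * ln a
     - (1 / 2) * ln (det \<Gamma>)
     - (1 / (2 * a)) * ((z - \<theta> *\<^sub>R T) \<bullet> (matrix_inv \<Gamma> *v (z - \<theta> *\<^sub>R T))))"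

definition theta_hat :: "real ^ 'n ^ 'n \<Rightarrow> real ^ 'n \<Rightarrow> real ^ 'n::finite \<Rightarrow> real" where
  "theta_hat \<Gamma> T z = (T \<bullet> (matrix_inv \<Gamma> *v z)) / (T \<bullet> (matrix_inv \<Gamma> *v T))"

definition alpha_sq_hat :: "real ^ 'n ^ 'n \<Rightarrow> real ^ 'n \<Rightarrow> real ^ 'n::finite \<Rightarrow> real" where
  "alpha_sq_hat \<Gamma> T z = (1 / real CARD('n)) *
     (z \<bullet> (matrix_inv \<Gamma> *v z) -
      (T \<bullet> (matrix_inv \<Gamma> *v z))\<^sup>2 / (T \<bullet> (matrix_inv \<Gamma> *v T)))"

end

theory Submission
  imports Defs
begin

text \<open>Profiling out \<open>\<theta>\<close> turns the quadratic form of the likelihood into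
  \<open>A (\<theta> - \<theta>')\<^sup>2 + N a'\<close>, with \<open>A > 0\<close> and \<open>(\<theta>', a')\<close> the claimed maximiser, and the remaining
  one-dimensional problem is \<open>ln x < x - 1\<close> for \<open>x = a' / a\<close> other than \<open>1\<close>. This needs
  \<open>\<Gamma>\<close> to be positive definite and \<open>Z\<close> not to be a multiple of \<open>T\<close>.

  Passing to increments, positive definiteness of \<open>\<Gamma>\<close> becomes that of a Toeplitz matrix whose
  symbol (the autocovariance of fractional Gaussian noise) is nonnegative, decreasing and convex
  when \<open>H > 1 / 2\<close>. Following Polya, such a sequence is a nonnegative combination of triangle
  functions, each of which is positive semidefinite, and the narrowest one, which gives the identity
  matrix, has a positive weight.

  If \<open>Z\<close> is a multiple of \<open>T\<close>, the contrast \<open>Z(2h) - 2 Z(h)\<close> vanishes; the drift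
  cancels in it, and what is left is a nondegenerate Gaussian variable.\<close>

section \<open>Second differences of power functions\<close>

text \<open>By the mean value theorem the two consecutive increments are values of \<open>f'\<close>
  in the two halves of the interval. Derivatives are confined to the open interval because
  \<open>x powr q\<close> is used with left end 0.\<close>

lemma second_difference_nonneg:
  fixes f f' :: "real \<Rightarrow> real"
  assumes cont: "continuous_on {a..a+2} f"
    and deriv: "\<And>x. a < x \<Longrightarrow> x < a + 2 \<Longrightarrow> (f has_real_derivative f' x) (at x)"
    and mono: "\<And>x y. a < x \<Longrightarrow> x \<le> y \<Longrightarrow> y < a + 2 \<Longrightarrow> f' x \<le> f' y"
  shows "0 \<le> f a - 2 * f (a + 1) + f (a + 2)"
proof -
  have mvt: "\<exists>z. b < z \<and> z < b + 1 \<and> f (b + 1) - f b = f' z" if "a \<le> b" "b \<le> a + 1" for b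
  proof -
    have "continuous_on {b..b+1} f"
      using cont by (rule continuous_on_subset) (use that in auto)
    moreover have "f differentiable at x" if "b < x" "x < b + 1" for x
      using deriv[of x] \<open>a \<le> b\<close> \<open>b \<le> a + 1\<close> that by (auto simp: real_differentiable_def)
    ultimately obtain l z where z: "b < z" "z < b + 1" "(f has_real_derivative l) (at z)"
        "f (b + 1) - f b = (b + 1 - b) * l"
      using MVT[of b "b + 1" f] by auto
    moreover have "l = f' z"
      using DERIV_unique[OF z(3) deriv] z that by auto
    ultimately show ?thesis by auto
  qed
  obtain y where y: "a < y" "y < a + 1" "f (a + 1) - f a = f' y"
    using mvt[of a] by auto
  obtain z where z: "a + 1 < z" "z < a + 2" "f (a + 2) - f (a + 1) = f' z"
    using mvt[of "a + 1"] by (auto simp: add.assoc)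
  from mono[of y z] y z show ?thesis by simp
qed

text \<open>For \<open>q = 2 * H\<close> and integers \<open>x\<close> from 1 on this is twice the
  autocovariance of fractional Gaussian noise; the real argument admits calculus.\<close>

definition powr_diff2 :: "real \<Rightarrow> real \<Rightarrow> real" where
  "powr_diff2 q x = (x + 1) powr q - 2 * x powr q + (x - 1) powr q"

text \<open>Convexity of \<open>x powr q\<close> decides the sign. Each derivative lowers the
  exponent by one, so for \<open>q\<close> between 1 and 2 three regimes occur: convex for
  \<open>q\<close>, concave for \<open>q - 1\<close>, convex for \<open>q - 2\<close>.\<close>

lemma powr_diff2_nonneg_ge1:
  assumes "1 \<le> q" "1 \<le> x"
  shows "0 \<le> powr_diff2 q x"
proof -
  have "0 \<le> (x - 1) powr q - 2 * (x - 1 + 1) powr q + (x - 1 + 2) powr q"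
  proof (rule second_difference_nonneg[where f' = "\<lambda>x. q * x powr (q - 1)"])
    show "continuous_on {x - 1..x - 1 + 2} (\<lambda>x. x powr q)"
      using assms by (intro continuous_on_powr') auto
  qed (use assms in \<open>auto intro!: has_real_derivative_powr mult_left_mono powr_mono2\<close>)
  then show ?thesis by (simp add: powr_diff2_def add.commute)
qed

text \<open>The point \<open>x = 1\<close> is a true exception: \<open>0 powr q\<close> is 0, so the
  value there is \<open>2 powr q - 2 < 0\<close>.\<close>

lemma powr_diff2_nonneg_le0:
  assumes "q \<le> 0" "1 < x"
  shows "0 \<le> powr_diff2 q x"
proof -
  have "0 \<le> (x - 1) powr q - 2 * (x - 1 + 1) powr q + (x - 1 + 2) powr q"
  proof (rule second_difference_nonneg[where f' = "\<lambda>x. q * x powr (q - 1)"])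
    show "continuous_on {x - 1..x - 1 + 2} (\<lambda>x. x powr q)"
      using assms by (intro continuous_on_powr') auto
  qed (use assms in \<open>auto intro!: has_real_derivative_powr mult_left_mono_neg powr_mono2'\<close>)
  then show ?thesis by (simp add: powr_diff2_def add.commute)
qed

lemma powr_diff2_nonpos:
  assumes "0 \<le> q" "q \<le> 1" "1 < x"
  shows "powr_diff2 q x \<le> 0"
proof -
  have "0 \<le> - ((x - 1) powr q) - 2 * - ((x - 1 + 1) powr q) + - ((x - 1 + 2) powr q)"
  proof (rule second_difference_nonneg[where f' = "\<lambda>x. - (q * x powr (q - 1))"])
    show "continuous_on {x - 1..x - 1 + 2} (\<lambda>x. - (x powr q))"
      using assms by (intro continuous_on_minus continuous_on_powr') auto
  qed (use assms in \<open>auto intro!: DERIV_minus has_real_derivative_powr mult_left_mono powr_mono2'\<close>)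
  then show ?thesis by (simp add: powr_diff2_def add.commute)
qed

lemma has_real_derivative_powr_diff2:
  assumes "1 < x"
  shows "(powr_diff2 q has_real_derivative q * powr_diff2 (q - 1) x) (at x)"
  unfolding powr_diff2_def[abs_def]
  using assms by (auto intro!: derivative_eq_intros simp: algebra_simps)

lemma continuous_on_powr_diff2:
  assumes "0 < q"
  shows "continuous_on {1..} (powr_diff2 q)"
  unfolding powr_diff2_def[abs_def]
  using assms by (intro continuous_intros continuous_on_powr') auto

lemma powr_diff2_antimono:
  assumes q: "1 < q" "q < 2" and x: "1 \<le> x" "x \<le> y"
  shows "powr_diff2 q y \<le> powr_diff2 q x"
proof (cases "x = y")
  case False
  show ?thesis
  proof (rule DERIV_nonpos_imp_decreasing_open[of x y "powr_diff2 q"])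
    fix z assume "x < z" "z < y"
    then show "\<exists>d. (powr_diff2 q has_real_derivative d) (at z) \<and> d \<le> 0"
      using has_real_derivative_powr_diff2[of z q] powr_diff2_nonpos[of "q - 1" z] q x
      by (intro exI[of _ "q * powr_diff2 (q - 1) z"]) (auto simp: mult_le_0_iff)
  qed (use x q in \<open>auto intro: continuous_on_subset[OF continuous_on_powr_diff2]\<close>)
qed simp

text \<open>The derivative \<open>q * powr_diff2 (q - 1)\<close> is nondecreasing, because its own
  derivative is a positive multiple of the second difference of the convex power with exponent
  \<open>q - 2 < 0\<close>.\<close>

lemma powr_diff2_convex:
  assumes q: "1 < q" "q < 2" and x: "1 \<le> x"
  shows "0 \<le> powr_diff2 q x - 2 * powr_diff2 q (x + 1) + powr_diff2 q (x + 2)"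
proof (rule second_difference_nonneg[where f' = "\<lambda>x. q * powr_diff2 (q - 1) x"])
  show "continuous_on {x..x+2} (powr_diff2 q)"
    using q x by (intro continuous_on_subset[OF continuous_on_powr_diff2]) auto
next
  fix y z assume yz: "x < y" "y \<le> z" "z < x + 2"
  have "powr_diff2 (q - 1) y \<le> powr_diff2 (q - 1) z"
  proof (rule DERIV_nonneg_imp_nondecreasing[OF yz(2)])
    fix u assume "y \<le> u" "u \<le> z"
    then show "\<exists>d. (powr_diff2 (q - 1) has_real_derivative d) (at u) \<and> 0 \<le> d"
      using has_real_derivative_powr_diff2[of u "q - 1"] powr_diff2_nonneg_le0[of "q - 1 - 1" u] q x yz
      by (intro exI[of _ "(q - 1) * powr_diff2 (q - 1 - 1) u"]) auto
  qed
  then show "q * powr_diff2 (q - 1) y \<le> q * powr_diff2 (q - 1) z"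
    using q by simp
qed (use has_real_derivative_powr_diff2 x in auto)

section \<open>Autocovariance of fractional Gaussian noise\<close>

text \<open>This is the fourth difference of \<open>|x| powr p\<close> over the points -1 to 3,
  twice the second difference of the autocovariance at lag 1. The kink at 0 puts it beyond the
  convexity argument above. It vanishes at \<open>p = 2\<close> and decreases strictly up to
  there.\<close>

lemma fourth_difference_powr_pos:
  fixes p :: real
  assumes "p < 2"
  shows "0 < 3 powr p - 4 * 2 powr p + 7"
proof -
  have "(\<lambda>p. 3 powr p - 4 * 2 powr p + 7 :: real) 2 < (\<lambda>p. 3 powr p - 4 * 2 powr p + 7 :: real) p"
  proof (rule DERIV_neg_imp_decreasing_open[OF assms])
    fix x :: real assume x: "p < x" "x < 2"
    \<comment> \<open>The derivative is negative since \<open>(3/2) powr x < 9/4\<close> for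
      \<open>x < 2\<close> and \<open>9 * ln 3 < 16 * ln 2\<close>; the latter is 3^9 = 19683 <
      65536 = 2^16.\<close>
    have "9 * ln 3 = ln ((3::real) ^ 9)" "16 * ln 2 = ln ((2::real) ^ 16)"
      by (subst ln_realpow; simp)+
    then have ln: "9 * ln 3 < 16 * ln (2::real)" by simp
    have "(3/2) powr x < (3/2 :: real) powr 2"
      using x by (intro powr_less_mono) auto
    then have "3 powr x < 9 / 4 * (2::real) powr x"
      by (simp add: powr_divide field_simps)
    then have "3 powr x * ln 3 < 9 / 4 * 2 powr x * ln (3::real)"
      by (intro mult_strict_right_mono) auto
    also have "\<dots> = 2 powr x / 4 * (9 * ln 3)" by simp
    also have "\<dots> < 2 powr x / 4 * (16 * ln 2)"
      using ln by (intro mult_strict_left_mono) auto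
    finally have "3 powr x * ln 3 - 4 * (2 powr x * ln 2) < (0::real)" by (simp add: mult_ac)
    moreover have "((\<lambda>p. 3 powr p - 4 * 2 powr p + 7 :: real) has_real_derivative
        3 powr x * ln 3 - 4 * (2 powr x * ln 2)) (at x)"
      by (auto intro!: derivative_eq_intros simp: algebra_simps)
    ultimately show "\<exists>d. ((\<lambda>p. 3 powr p - 4 * 2 powr p + 7 :: real) has_real_derivative d) (at x) \<and> d < 0"
      by blast
  qed (auto intro!: continuous_intros)
  then show ?thesis by simp
qed

text \<open>With \<open>p = 2 * H\<close>, the covariance of two unit increments of fractional
  Brownian motion at distance \<open>n\<close>. The absolute value covers \<open>n = 0\<close>,
  where the result is 1.\<close>

definition fgn_cov :: "real \<Rightarrow> nat \<Rightarrow> real" where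
  "fgn_cov p n = (real (n + 1) powr p - 2 * real n powr p + \<bar>real n - 1\<bar> powr p) / 2"

lemma fgn_cov_eq_powr_diff2: "1 \<le> n \<Longrightarrow> fgn_cov p n = powr_diff2 p (real n) / 2"
  by (simp add: fgn_cov_def powr_diff2_def add.commute)

text \<open>For \<open>n\<close> at least 2 all three lags are at least 1 and
  \<open>powr_diff2\<close> applies; only \<open>n = 1\<close> involves lag 0 and takes the fourth
  difference.\<close>

lemma fgn_cov_convex:
  assumes "1 < p" "p < 2" "1 \<le> n"
  shows "0 \<le> fgn_cov p (n - 1) - 2 * fgn_cov p n + fgn_cov p (n + 1)"
proof (cases "n = 1")
  case True
  then show ?thesis
    using fourth_difference_powr_pos[of p] assms by (simp add: fgn_cov_def field_simps)
next
  case False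
  then show ?thesis
    using powr_diff2_convex[of p "real (n - 1)"] assms
    by (simp add: fgn_cov_eq_powr_diff2 of_nat_diff)
qed

lemma fgn_cov_strictly_convex_at_1:
  assumes "p < 2"
  shows "0 < fgn_cov p 0 - 2 * fgn_cov p 1 + fgn_cov p 2"
  using fourth_difference_powr_pos[of p] assms by (simp add: fgn_cov_def field_simps)

lemma fgn_cov_nonneg: "1 < p \<Longrightarrow> 0 \<le> fgn_cov p n"
  by (cases "n = 0") (auto simp: fgn_cov_eq_powr_diff2 powr_diff2_nonneg_ge1, simp add: fgn_cov_def)

lemma fgn_cov_antimono_Suc:
  assumes "1 < p" "p < 2"
  shows "fgn_cov p (Suc n) \<le> fgn_cov p n"
proof -
  have *: "fgn_cov p (Suc n) \<le> fgn_cov p n" if "1 \<le> n" for n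
    using powr_diff2_antimono[of p "real n" "real (Suc n)"] assms that
    by (simp add: fgn_cov_eq_powr_diff2)
  show ?thesis
  proof (cases "n = 0")
    case True
    \<comment> \<open>Convexity at lag 1 bounds the first decrease from below by the second one,
      which is nonnegative by \<open>*\<close>.\<close>
    then show ?thesis
      using fgn_cov_convex[OF assms, of 1] *[of 1] by simp
  qed (use * in auto)
qed

section \<open>Polya's criterion for Toeplitz matrices\<close>

text \<open>In truncated subtraction \<open>(i - j) + (j - i)\<close> is the distance of \<open>i\<close> and \<open>j\<close>, and
  \<open>k - d\<close> is the positive part.\<close>

lemma triangle_quadratic_form:
  fixes d :: "nat \<Rightarrow> real"
  shows "(\<Sum>i<N. \<Sum>j<N. d i * d j * real (k - ((i - j) + (j - i)))) =
    (\<Sum>s<N + k. (\<Sum>i<N. d i * of_bool (i \<le> s \<and> s < i + k))\<^sup>2)"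
proof -
  \<comment> \<open>The windows [i, i + k) and [j, j + k) share as many integers as the triangle
    function says, so the triangle is a Gram matrix of indicators. The bound \<open>N + k\<close>
    lies beyond every window.\<close>
  have overlap: "real (k - ((i - j) + (j - i))) =
      (\<Sum>s<N + k. of_bool (i \<le> s \<and> s < i + k) * of_bool (j \<le> s \<and> s < j + k))"
    if "i < N" "j < N" for i j
  proof -
    have "(\<Sum>s<N + k. of_bool (i \<le> s \<and> s < i + k) * of_bool (j \<le> s \<and> s < j + k) :: real) =
        (\<Sum>s<N + k. of_bool (s \<in> {max i j..<min i j + k}))"
      by (intro sum.cong) auto
    also have "\<dots> = real (card ({..<N + k} \<inter> {max i j..<min i j + k}))"
      by (simp add: Int_def)
    also have "{..<N + k} \<inter> {max i j..<min i j + k} = {max i j..<min i j + k}"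
      using that by auto
    also have "card \<dots> = k - ((i - j) + (j - i))"
      by auto
    finally show ?thesis by simp
  qed
  have "(\<Sum>i<N. \<Sum>j<N. d i * d j * real (k - ((i - j) + (j - i)))) =
     (\<Sum>i<N. \<Sum>j<N. \<Sum>s<N + k. (d i * of_bool (i \<le> s \<and> s < i + k)) * (d j * of_bool (j \<le> s \<and> s < j + k)))"
    by (intro sum.cong refl) (simp only: overlap lessThan_iff sum_distrib_left mult_ac)
  also have "\<dots> = (\<Sum>s<N + k. \<Sum>i<N. \<Sum>j<N. (d i * of_bool (i \<le> s \<and> s < i + k)) * (d j * of_bool (j \<le> s \<and> s < j + k)))"
    by (subst sum.swap, subst sum.swap, intro sum.cong refl sum.swap)
  also have "\<dots> = (\<Sum>s<N + k. (\<Sum>i<N. d i * of_bool (i \<le> s \<and> s < i + k))\<^sup>2)"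
    by (simp only: power2_eq_square sum_product)
  finally show ?thesis .
qed

text \<open>Summation by parts twice: a discrete Taylor formula at \<open>N\<close> in which second
  differences weight the triangles.\<close>

lemma triangle_expansion:
  fixes g :: "nat \<Rightarrow> real"
  assumes "n \<le> N" "1 \<le> N"
  shows "g n = g N + (g (N - 1) - g N) * real (N - n) +
    (\<Sum>k=1..<N. (g (k - 1) - 2 * g k + g (k + 1)) * real (k - n))"
  using assms(2,1)
proof (induction N rule: dec_induct)
  case base
  then have "n = 0 \<or> n = 1" by auto
  then show ?case by auto
next
  case (step N)
  show ?case
  proof (cases "n \<le> N")
    case True
    then show ?thesis
      using step.IH step.hyps by (simp add: of_nat_diff algebra_simps)
  next
    case False
    then have "n = Suc N" using step.prems by simp
    then show ?thesis by simp
  qed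
qed

text \<open>Nonnegativity and monotonicity control the two end-point terms of the expansion,
  convexity the remaining weights; \<open>strict\<close> makes the weight of the identity matrix,
  which is the triangle with \<open>k = 1\<close>, positive.\<close>

lemma convex_sequence_toeplitz_pos:
  fixes g d :: "nat \<Rightarrow> real"
  assumes convex: "\<And>k. 1 \<le> k \<Longrightarrow> 0 \<le> g (k - 1) - 2 * g k + g (k + 1)"
    and strict: "0 < g 0 - 2 * g 1 + g 2"
    and antimono: "\<And>k. g (Suc k) \<le> g k"
    and nonneg: "\<And>k. 0 \<le> g k"
    and d: "i0 < N" "d i0 \<noteq> 0"
  shows "0 < (\<Sum>i<N. \<Sum>j<N. d i * d j * g ((i - j) + (j - i)))"
proof -
  \<comment> \<open>\<open>K\<close> bounds all distances and keeps the index 1 inside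
    \<open>{1..<K}\<close>.\<close>
  define K where "K = Suc (Suc N)"
  define D where "D k = g (k - 1) - 2 * g k + g (k + 1)" for k
  define Q where "Q k = (\<Sum>i<N. \<Sum>j<N. d i * d j * real (k - ((i - j) + (j - i))))" for k
  have Q_nonneg: "0 \<le> Q k" for k
    unfolding Q_def triangle_quadratic_form by (intro sum_nonneg) auto
  have "Q 1 = (\<Sum>i<N. \<Sum>j<N. if i = j then (d i)\<^sup>2 else 0)"
    unfolding Q_def by (intro sum.cong refl) (auto simp: power2_eq_square)
  also have "\<dots> = (\<Sum>i<N. (d i)\<^sup>2)" by simp
  also have "\<dots> > 0"
    using d by (intro sum_pos2[of _ i0]) auto
  finally have Q1: "0 < Q 1" .
  have "(\<Sum>i<N. \<Sum>j<N. d i * d j * g ((i - j) + (j - i))) =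
      (\<Sum>i<N. \<Sum>j<N. g K * (d i * d j) +
        (g (K - 1) - g K) * (d i * d j * real (K - ((i - j) + (j - i)))) +
        (\<Sum>k=1..<K. D k * (d i * d j * real (k - ((i - j) + (j - i))))))"
  proof (intro sum.cong refl)
    fix i j assume "i \<in> {..<N}" "j \<in> {..<N}"
    then have "(i - j) + (j - i) \<le> K" by (auto simp: K_def)
    from triangle_expansion[OF this, of g]
    have "g ((i - j) + (j - i)) = g K + (g (K - 1) - g K) * real (K - ((i - j) + (j - i))) +
        (\<Sum>k=1..<K. D k * real (k - ((i - j) + (j - i))))"
      by (simp add: K_def D_def)
    then show "d i * d j * g ((i - j) + (j - i)) = g K * (d i * d j) +
        (g (K - 1) - g K) * (d i * d j * real (K - ((i - j) + (j - i)))) +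
        (\<Sum>k=1..<K. D k * (d i * d j * real (k - ((i - j) + (j - i)))))"
      by (simp only: distrib_left sum_distrib_left mult_ac)
  qed
  also have "\<dots> = g K * (\<Sum>i<N. d i)\<^sup>2 + (g (K - 1) - g K) * Q K + (\<Sum>k=1..<K. D k * Q k)"
  proof -
    have "(\<Sum>i<N. \<Sum>j<N. \<Sum>k=1..<K. D k * (d i * d j * real (k - ((i - j) + (j - i))))) =
        (\<Sum>k=1..<K. D k * Q k)"
      unfolding Q_def sum_distrib_left
      by (subst sum.swap, subst sum.swap, intro sum.cong refl sum.swap)
    then show ?thesis
      by (simp only: sum.distrib Q_def sum_distrib_left[symmetric] power2_eq_square sum_product)
  qed
  also have "\<dots> > 0"
  proof -
    have "0 < (\<Sum>k=1..<K. D k * Q k)"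
    proof (rule sum_pos2[of _ 1])
      show "0 < D 1 * Q 1"
        using strict Q1 by (simp add: D_def numeral_2_eq_2)
      show "0 \<le> D k * Q k" if "k \<in> {1..<K}" for k
        using that convex[of k] Q_nonneg[of k] by (simp add: D_def)
    qed (auto simp: K_def)
    moreover have "0 \<le> g K * (\<Sum>i<N. d i)\<^sup>2" using nonneg by simp
    moreover have "0 \<le> (g (K - 1) - g K) * Q K"
      using antimono[of "K - 1"] Q_nonneg by (simp add: K_def)
    ultimately show ?thesis by linarith
  qed
  finally show ?thesis .
qed

section \<open>Positive definiteness of the covariance matrix\<close>

text \<open>The value at time \<open>a\<close> is the sum of the first \<open>a\<close> unit
  increments; accordingly the double sum telescopes in both indices.\<close>

lemma fbm_cov_eq_sum_fgn_cov:
  "fbm_cov H (real a) (real b) = (\<Sum>i<a. \<Sum>j<b. fgn_cov (2 * H) ((i - j) + (j - i)))"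
proof -
  define \<phi> :: "real \<Rightarrow> real" where "\<phi> x = \<bar>x\<bar> powr (2 * H)" for x
  have fgn: "fgn_cov (2 * H) ((i - j) + (j - i)) =
      (\<phi> (real i - real j + 1) - 2 * \<phi> (real i - real j) + \<phi> (real i - real j - 1)) / 2" for i j :: nat
  proof (cases "i \<le> j")
    case True
    then obtain n where "j = i + n" using le_Suc_ex by blast
    then show ?thesis by (simp add: fgn_cov_def \<phi>_def abs_minus_commute add.commute)
  next
    case False
    then obtain n where "i = j + n" using le_Suc_ex nat_le_linear by blast
    then show ?thesis by (simp add: fgn_cov_def \<phi>_def abs_minus_commute add.commute)
  qed
  have inner: "(\<Sum>j<b. fgn_cov (2 * H) ((i - j) + (j - i))) =
      ((\<phi> (real i + 1) - \<phi> (real i)) - (\<phi> (real i - real b + 1) - \<phi> (real i - real b))) / 2" for i :: nat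
  proof (induction b)
    case (Suc b)
    show ?case
      unfolding sum.lessThan_Suc Suc.IH unfolding fgn by (simp add: field_simps)
  qed simp
  have "(\<Sum>i<a. \<Sum>j<b. fgn_cov (2 * H) ((i - j) + (j - i))) =
      (\<phi> (real a) - \<phi> 0 - (\<phi> (real a - real b) - \<phi> (- real b))) / 2"
  proof (induction a)
    case (Suc a)
    show ?case
      unfolding sum.lessThan_Suc Suc.IH unfolding inner by (simp add: field_simps)
  qed simp
  then show ?thesis
    by (simp add: fbm_cov_def \<phi>_def)
qed

text \<open>Passing to increments turns the coefficients \<open>c\<close> into their tail sums
  \<open>d\<close> and the covariance into a Toeplitz matrix. The change of variables is triangular:
  at the last index \<open>top\<close> with a nonzero coefficient, \<open>d top = c top\<close>, so
  \<open>d\<close> is nonzero.\<close>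

lemma fbm_cov_quadratic_form_pos:
  fixes c :: "nat \<Rightarrow> real"
  assumes H: "1 / 2 < H" "H < 1" and c: "a0 < N" "c a0 \<noteq> 0"
  shows "0 < (\<Sum>a<N. \<Sum>b<N. c a * c b * fbm_cov H (real (Suc a)) (real (Suc b)))"
proof -
  define d where "d i = (\<Sum>a<N. c a * of_bool (i \<le> a))" for i
  define g where "g = fgn_cov (2 * H)"
  define top where "top = Max {a. a < N \<and> c a \<noteq> 0}"
  have fin: "finite {a. a < N \<and> c a \<noteq> 0}" by auto
  have "top \<in> {a. a < N \<and> c a \<noteq> 0}"
    unfolding top_def using c by (intro Max_in fin) auto
  then have top: "top < N" "c top \<noteq> 0" by auto
  have above: "c a = 0" if "top < a" "a < N" for a
    using Max_ge[OF fin, of a] that unfolding top_def by (metis (mono_tags, lifting) mem_Collect_eq not_le)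
  have "d top = (\<Sum>a<N. if a = top then c a else 0)"
    unfolding d_def using above by (intro sum.cong) force+
  then have "d top \<noteq> 0" using top by simp
  have "(\<Sum>a<N. \<Sum>b<N. c a * c b * fbm_cov H (real (Suc a)) (real (Suc b))) =
      (\<Sum>a<N. \<Sum>b<N. \<Sum>i<N. \<Sum>j<N. (c a * of_bool (i \<le> a)) * (c b * of_bool (j \<le> b)) * g ((i - j) + (j - i)))"
  proof (intro sum.cong refl)
    fix a b assume ab: "a \<in> {..<N}" "b \<in> {..<N}"
    \<comment> \<open>Time \<open>Suc a\<close> comprises the increments 0 to \<open>a\<close>.
      Indicators extend the sums to a common range, so that their order can be changed.\<close>
    have restr: "(\<Sum>i<Suc n. f i) = (\<Sum>i<N. of_bool (i \<le> n) * f i)" if "n < N" for n and f :: "nat \<Rightarrow> real"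
      using that by (intro sum.mono_neutral_cong_left) auto
    have "fbm_cov H (real (Suc a)) (real (Suc b)) =
        (\<Sum>i<N. of_bool (i \<le> a) * (\<Sum>j<N. of_bool (j \<le> b) * g ((i - j) + (j - i))))"
      unfolding fbm_cov_eq_sum_fgn_cov g_def using ab by (simp only: restr lessThan_iff)
    then show "c a * c b * fbm_cov H (real (Suc a)) (real (Suc b)) =
        (\<Sum>i<N. \<Sum>j<N. (c a * of_bool (i \<le> a)) * (c b * of_bool (j \<le> b)) * g ((i - j) + (j - i)))"
      by (simp only: sum_distrib_left mult_ac)
  qed
  also have "\<dots> = (\<Sum>a<N. \<Sum>i<N. \<Sum>b<N. \<Sum>j<N. (c a * of_bool (i \<le> a)) * (c b * of_bool (j \<le> b)) * g ((i - j) + (j - i)))"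
    by (intro sum.cong refl sum.swap)
  also have "\<dots> = (\<Sum>i<N. \<Sum>a<N. \<Sum>b<N. \<Sum>j<N. (c a * of_bool (i \<le> a)) * (c b * of_bool (j \<le> b)) * g ((i - j) + (j - i)))"
    by (rule sum.swap)
  also have "\<dots> = (\<Sum>i<N. \<Sum>a<N. \<Sum>j<N. \<Sum>b<N. (c a * of_bool (i \<le> a)) * (c b * of_bool (j \<le> b)) * g ((i - j) + (j - i)))"
    by (intro sum.cong refl sum.swap)
  also have "\<dots> = (\<Sum>i<N. \<Sum>j<N. \<Sum>a<N. \<Sum>b<N. (c a * of_bool (i \<le> a)) * (c b * of_bool (j \<le> b)) * g ((i - j) + (j - i)))"
    by (intro sum.cong refl sum.swap)
  also have "\<dots> = (\<Sum>i<N. \<Sum>j<N. d i * d j * g ((i - j) + (j - i)))"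
    unfolding d_def by (intro sum.cong refl, subst sum_product) (simp only: sum_distrib_right)
  also have "\<dots> > 0"
    using H \<open>d top \<noteq> 0\<close> top unfolding g_def
    by (intro convex_sequence_toeplitz_pos[where ?i0.0 = top] fgn_cov_convex fgn_cov_strictly_convex_at_1
        fgn_cov_antimono_Suc fgn_cov_nonneg) auto
  finally show ?thesis .
qed

text \<open>Self-similarity reduces the mesh \<open>h\<close> to mesh 1.\<close>

lemma fbm_cov_scale:
  assumes "0 \<le> h" "0 \<le> s" "0 \<le> t"
  shows "fbm_cov H (s * h) (t * h) = h powr (2 * H) * fbm_cov H s t"
proof -
  have "\<bar>s * h - t * h\<bar> = \<bar>s - t\<bar> * h"
    using assms by (simp add: abs_mult flip: left_diff_distrib)
  then show ?thesis
    using assms by (simp add: fbm_cov_def powr_mult field_simps)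
qed

lemma fbm_cov_sym: "fbm_cov H s t = fbm_cov H t s"
  by (simp add: fbm_cov_def abs_minus_commute)

lemma Gamma_H_pos:
  fixes k :: "'n::finite \<Rightarrow> nat" and x :: "real ^ 'n"
  assumes "0 < h" "1 \<le> m" and H: "\<And>r. r \<in> {1..m} \<Longrightarrow> 1 / 2 < H r \<and> H r < 1"
    and k: "bij_betw k (UNIV :: 'n set) {1..CARD('n)}" and "x \<noteq> 0"
  shows "0 < x \<bullet> (Gamma_H m H (obs_times k h) *v x)"
proof -
  \<comment> \<open>\<open>g a\<close> is the coordinate observed at time
    \<open>(a + 1) * h\<close>; it reorders the sums by time.\<close>
  define g where "g a = inv_into UNIV k (Suc a)" for a
  have "bij_betw Suc {..<CARD('n)} {1..CARD('n)}"
    by (simp add: bij_betw_def image_Suc_lessThan)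
  from bij_betw_trans[OF this bij_betw_inv_into[OF k]]
  have g: "bij_betw g {..<CARD('n)} UNIV"
    by (simp add: g_def[abs_def] comp_def)
  have kg: "k (g a) = Suc a" if "a < CARD('n)" for a
    using bij_betw_inv_into_right[OF k, of "Suc a"] that by (simp add: g_def)
  obtain i where "x $ i \<noteq> 0" using \<open>x \<noteq> 0\<close> by (auto simp: vec_eq_iff)
  then obtain a0 where a0: "a0 < CARD('n)" "x $ g a0 \<noteq> 0"
    using g by (metis UNIV_I bij_betw_def imageE lessThan_iff)
  have "x \<bullet> (Gamma_H m H (obs_times k h) *v x) =
      (\<Sum>i\<in>UNIV. \<Sum>j\<in>UNIV. x $ i * x $ j * Gamma_H m H (obs_times k h) $ i $ j)"
    by (simp add: inner_vec_def matrix_vector_mult_def sum_distrib_left mult_ac)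
  also have "\<dots> = (\<Sum>i\<in>UNIV. \<Sum>j\<in>UNIV. \<Sum>r=1..m.
      x $ i * x $ j * (h powr (2 * H r) * fbm_cov (H r) (real (k i)) (real (k j))))"
    using \<open>0 < h\<close> by (simp add: Gamma_H_def obs_times_def fbm_cov_scale sum_distrib_left)
  also have "\<dots> = (\<Sum>r=1..m. \<Sum>i\<in>UNIV. \<Sum>j\<in>UNIV. x $ i * x $ j * (h powr (2 * H r) * fbm_cov (H r) (real (k i)) (real (k j))))"
    by (subst sum.swap, subst sum.swap, intro sum.cong refl sum.swap)
  also have "\<dots> = (\<Sum>r=1..m. h powr (2 * H r) *
      (\<Sum>i\<in>UNIV. \<Sum>j\<in>UNIV. x $ i * x $ j * fbm_cov (H r) (real (k i)) (real (k j))))"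
    by (simp only: sum_distrib_left mult_ac)
  also have "\<dots> > 0"
  proof (rule sum_pos)
    fix r assume "r \<in> {1..m}"
    have "(\<Sum>i\<in>UNIV. \<Sum>j\<in>UNIV. x $ i * x $ j * fbm_cov (H r) (real (k i)) (real (k j))) =
        (\<Sum>a<CARD('n). \<Sum>b<CARD('n). x $ g a * x $ g b * fbm_cov (H r) (real (k (g a))) (real (k (g b))))"
      by (simp only: sum.reindex_bij_betw[OF g, symmetric])
    also have "\<dots> = (\<Sum>a<CARD('n). \<Sum>b<CARD('n). x $ g a * x $ g b * fbm_cov (H r) (real (Suc a)) (real (Suc b)))"
      by (intro sum.cong refl) (simp add: kg)
    also have "\<dots> > 0"
      using H[OF \<open>r \<in> {1..m}\<close>] a0 by (intro fbm_cov_quadratic_form_pos) auto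
    finally show "0 < h powr (2 * H r) *
        (\<Sum>i\<in>UNIV. \<Sum>j\<in>UNIV. x $ i * x $ j * fbm_cov (H r) (real (k i)) (real (k j)))"
      using \<open>0 < h\<close> by simp
  qed (use assms in auto)
  finally show ?thesis .
qed

lemma transpose_Gamma_H: "transpose (Gamma_H m H T) = Gamma_H m H T"
  by (simp add: vec_eq_iff transpose_def Gamma_H_def fbm_cov_sym)

section \<open>Positive definite forms and the maximum of the likelihood\<close>

lemma symmetric_matrix_inner:
  fixes A :: "real ^ 'n ^ 'n"
  assumes "transpose A = A"
  shows "x \<bullet> (A *v y) = (A *v x) \<bullet> y"
  by (metis assms dot_lmul_matrix vector_transpose_matrix)

lemma posdef_matrix_inv_right:
  fixes A :: "real ^ 'n ^ 'n"
  assumes "\<And>x. x \<noteq> 0 \<Longrightarrow> 0 < x \<bullet> (A *v x)"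
  shows "A *v (matrix_inv A *v x) = x"
proof -
  have "invertible A"
    unfolding invertible_left_inverse matrix_left_invertible_ker
    using assms by (metis inner_zero_right less_irrefl)
  then have "A ** matrix_inv A = mat 1"
    unfolding invertible_def matrix_inv_def by (metis (mono_tags, lifting) someI_ex)
  then show ?thesis by (simp add: matrix_vector_mul_assoc)
qed

lemma posdef_matrix_inv_sym:
  fixes A :: "real ^ 'n ^ 'n"
  assumes "transpose A = A" "\<And>x. x \<noteq> 0 \<Longrightarrow> 0 < x \<bullet> (A *v x)"
  shows "x \<bullet> (matrix_inv A *v y) = (matrix_inv A *v x) \<bullet> y"
  by (metis assms posdef_matrix_inv_right symmetric_matrix_inner)

lemma posdef_matrix_inv_pos:
  fixes A :: "real ^ 'n ^ 'n"
  assumes pos: "\<And>x. x \<noteq> 0 \<Longrightarrow> 0 < x \<bullet> (A *v x)" and "x \<noteq> 0"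
  shows "0 < x \<bullet> (matrix_inv A *v x)"
proof -
  have inv: "A *v (matrix_inv A *v x) = x"
    using pos by (rule posdef_matrix_inv_right)
  then have "matrix_inv A *v x \<noteq> 0"
    using \<open>x \<noteq> 0\<close> by (metis matrix_vector_mult_0_right)
  from pos[OF this] show ?thesis
    by (simp add: inv inner_commute)
qed

text \<open>The deterministic core. The condition on \<open>z\<close> keeps the residual nonzero; on
  the line spanned by \<open>T\<close> the likelihood would be unbounded as the scale tends to
  0.\<close>

lemma log_likelihood_unique_maximum:
  fixes \<Gamma> :: "real ^ 'n ^ 'n" and T z :: "real ^ 'n::finite"
  assumes sym: "transpose \<Gamma> = \<Gamma>" and pos: "\<And>x. x \<noteq> 0 \<Longrightarrow> 0 < x \<bullet> (\<Gamma> *v x)"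
    and "T \<noteq> 0" and z: "\<And>c. z \<noteq> c *\<^sub>R T"
  shows "is_arg_max (log_likelihood \<Gamma> T z) (\<lambda>q. q \<in> UNIV \<times> {0<..}) p
    \<longleftrightarrow> p = (theta_hat \<Gamma> T z, alpha_sq_hat \<Gamma> T z)"
proof -
  define P where "P = matrix_inv \<Gamma>"
  define A where "A = T \<bullet> (P *v T)"
  define b where "b = T \<bullet> (P *v z)"
  define \<theta>0 where "\<theta>0 = theta_hat \<Gamma> T z"
  define a0 where "a0 = alpha_sq_hat \<Gamma> T z"
  define N where "N = real CARD('n)"
  have "0 < N" by (simp add: N_def)
  have "0 < A"
    unfolding A_def P_def using pos \<open>T \<noteq> 0\<close> by (rule posdef_matrix_inv_pos)
  have \<theta>0: "\<theta>0 = b / A" by (simp add: \<theta>0_def theta_hat_def A_def b_def P_def)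
  have a0: "N * a0 = z \<bullet> (P *v z) - b\<^sup>2 / A"
    by (simp add: a0_def alpha_sq_hat_def A_def b_def P_def N_def)
  have "z \<bullet> (P *v T) = b"
    unfolding b_def P_def using posdef_matrix_inv_sym[OF sym pos] by (simp add: inner_commute)
  then have "(z - \<theta> *\<^sub>R T) \<bullet> (P *v (z - \<theta> *\<^sub>R T)) = z \<bullet> (P *v z) - 2 * \<theta> * b + \<theta>\<^sup>2 * A" for \<theta>
    by (simp add: matrix_vector_mult_diff_distrib matrix_vector_mult_scaleR inner_diff_left
        inner_diff_right A_def b_def power2_eq_square algebra_simps)
  also have "z \<bullet> (P *v z) - 2 * \<theta> * b + \<theta>\<^sup>2 * A = A * (\<theta> - \<theta>0)\<^sup>2 + N * a0" for \<theta>
    unfolding a0 \<theta>0 using \<open>0 < A\<close> by (simp add: field_simps power2_eq_square)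
  finally have quad: "(z - \<theta> *\<^sub>R T) \<bullet> (P *v (z - \<theta> *\<^sub>R T)) = A * (\<theta> - \<theta>0)\<^sup>2 + N * a0" for \<theta> .
  \<comment> \<open>At \<open>\<theta>0\<close> the square in \<open>quad\<close> vanishes, so
    \<open>N * a0\<close> is the form of a nonzero residual and the candidate lies in the
    domain.\<close>
  have "0 < (z - \<theta>0 *\<^sub>R T) \<bullet> (P *v (z - \<theta>0 *\<^sub>R T))"
    unfolding P_def using pos z by (intro posdef_matrix_inv_pos) auto
  then have "0 < a0" using \<open>0 < N\<close> by (simp add: quad zero_less_mult_iff)
  have less: "log_likelihood \<Gamma> T z (\<theta>, a) < log_likelihood \<Gamma> T z (\<theta>0, a0)"
    if "0 < a" "(\<theta>, a) \<noteq> (\<theta>0, a0)" for \<theta> a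
  proof -
    \<comment> \<open>The first summand, \<open>N / 2\<close> times \<open>x - 1 - ln x\<close> at
      \<open>x = a0 / a\<close>, is the loss from a wrong scale; the second is that from a wrong
      drift.\<close>
    have "log_likelihood \<Gamma> T z (\<theta>0, a0) - log_likelihood \<Gamma> T z (\<theta>, a) =
        N / 2 * ((a0 - a) / a - (ln a0 - ln a)) + A * (\<theta> - \<theta>0)\<^sup>2 / (2 * a)"
      unfolding log_likelihood_def prod.case P_def[symmetric] quad N_def[symmetric]
      using \<open>0 < a0\<close> \<open>0 < a\<close> by (simp add: field_simps)
    also have "\<dots> > 0"
    proof (cases "a = a0")
      \<comment> \<open>With equal scales the drifts differ, so the second summand is
        positive.\<close>
      case True
      then show ?thesis using that \<open>0 < A\<close> \<open>0 < a0\<close> by simp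
    next
      case False
      then have "0 < N / 2 * ((a0 - a) / a - (ln a0 - ln a))"
        using ln_diff_less[of a0 a] that \<open>0 < a0\<close> \<open>0 < N\<close> by (intro mult_pos_pos) auto
      moreover have "0 \<le> A * (\<theta> - \<theta>0)\<^sup>2 / (2 * a)"
        using \<open>0 < A\<close> that by simp
      ultimately show ?thesis by linarith
    qed
    finally show ?thesis by simp
  qed
  show ?thesis
  proof
    assume "is_arg_max (log_likelihood \<Gamma> T z) (\<lambda>q. q \<in> UNIV \<times> {0<..}) p"
    then show "p = (theta_hat \<Gamma> T z, alpha_sq_hat \<Gamma> T z)"
      using less[of "snd p" "fst p"] \<open>0 < a0\<close>
      unfolding is_arg_max_def \<theta>0_def a0_def by (cases p) auto
  next
    assume "p = (theta_hat \<Gamma> T z, alpha_sq_hat \<Gamma> T z)"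
    then show "is_arg_max (log_likelihood \<Gamma> T z) (\<lambda>q. q \<in> UNIV \<times> {0<..}) p"
      using less \<open>0 < a0\<close>
      unfolding is_arg_max_def \<theta>0_def[symmetric] a0_def[symmetric] by (force simp: not_less)
  qed
qed

section \<open>Nondegeneracy of the contrast\<close>

lemma fbm_measurable:
  assumes "fractional_brownian_motion M H B" "0 \<le> t"
  shows "B t \<in> borel_measurable M"
proof -
  have "\<forall>F c. finite F \<and> F \<subseteq> {0..} \<longrightarrow> gaussian_rv M (\<lambda>\<omega>. \<Sum>s\<in>F. c s * B s \<omega>)"
    using assms(1) by (simp add: fractional_brownian_motion_def gaussian_process_on_def)
  then have "gaussian_rv M (\<lambda>\<omega>. \<Sum>s\<in>{t}. 1 * B s \<omega>)"
    using assms(2) by (elim allE[of _ "{t}"] allE[of _ "\<lambda>_. 1"] impE) auto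
  then show ?thesis by (simp add: gaussian_rv_def)
qed

text \<open>Since \<open>gaussian_rv\<close> admits constants, the variance decides: it is
  \<open>h powr (2 * H) * (4 - 2 powr (2 * H))\<close>, positive because
  \<open>H < 1\<close>.\<close>

lemma (in prob_space) fbm_contrast_normal:
  assumes fbm: "fractional_brownian_motion M H B" and H: "0 < H" "H < 1" and "0 < h"
  shows "\<exists>\<mu> \<sigma>. 0 < \<sigma> \<and> distributed M lborel (\<lambda>\<omega>. B (2 * h) \<omega> - 2 * B h \<omega>) (normal_density \<mu> \<sigma>)"
proof -
  define Y where "Y \<omega> = B (2 * h) \<omega> - 2 * B h \<omega>" for \<omega>
  have [measurable]: "B h \<in> borel_measurable M" "B (2 * h) \<in> borel_measurable M"
    using fbm_measurable[OF fbm] \<open>0 < h\<close> by auto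
  then have [measurable]: "Y \<in> borel_measurable M"
    unfolding Y_def[abs_def] by measurable
  have E: "expectation (\<lambda>\<omega>. B t \<omega> * B s \<omega>) = fbm_cov H t s"
    if "0 \<le> t" "0 \<le> s" for s t
    using fbm that by (auto simp: fractional_brownian_motion_def)
  have centred: "expectation (B t) = 0" if "0 \<le> t" for t
    using fbm that by (auto simp: fractional_brownian_motion_def)
  have hp: "0 < h powr (2 * H)" "0 < h powr (2 * H) * 2 powr (2 * H)"
    using \<open>0 < h\<close> by auto
  have cov: "fbm_cov H (2 * h) (2 * h) = h powr (2 * H) * 2 powr (2 * H)"
      "fbm_cov H (2 * h) h = h powr (2 * H) * 2 powr (2 * H) / 2"
      "fbm_cov H h h = h powr (2 * H)"
    using \<open>0 < h\<close> by (auto simp: fbm_cov_def powr_mult)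
  \<comment> \<open>The integral of a nonintegrable function is 0 by convention, so a nonzero second
    moment entails integrability.\<close>
  have int: "integrable M (\<lambda>\<omega>. B t \<omega> * B s \<omega>)" if "0 \<le> t" "0 \<le> s" "fbm_cov H t s \<noteq> 0" for s t
    using E[of t s] that not_integrable_integral_eq[of M "\<lambda>\<omega>. B t \<omega> * B s \<omega>"] by auto
  have int2: "integrable M (\<lambda>\<omega>. B (2 * h) \<omega> * B (2 * h) \<omega>)" "integrable M (\<lambda>\<omega>. B (2 * h) \<omega> * B h \<omega>)"
      "integrable M (\<lambda>\<omega>. B h \<omega> * B h \<omega>)"
    using \<open>0 < h\<close> hp int[of "2 * h" "2 * h"] int[of "2 * h" h] int[of h h] by (simp_all add: cov)
  have int1: "integrable M (B (2 * h))" "integrable M (B h)"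
    by (rule square_integrable_imp_integrable; use int2 in \<open>simp add: power2_eq_square\<close>)+
  have "expectation (\<lambda>\<omega>. Y \<omega> * Y \<omega>) = expectation (\<lambda>\<omega>. B (2 * h) \<omega> * B (2 * h) \<omega> -
      4 * (B (2 * h) \<omega> * B h \<omega>) + 4 * (B h \<omega> * B h \<omega>))"
    by (simp add: Y_def algebra_simps)
  also have "\<dots> = fbm_cov H (2 * h) (2 * h) - 4 * fbm_cov H (2 * h) h + 4 * fbm_cov H h h"
    using \<open>0 < h\<close> int2 by (simp add: E)
  also have "\<dots> = h powr (2 * H) * (4 - 2 powr (2 * H))"
    unfolding cov by (simp add: algebra_simps)
  also have "\<dots> > 0"
  proof -
    have "2 powr (2 * H) < (2::real) powr 2" using H by (intro powr_less_mono) auto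
    then show ?thesis using hp by simp
  qed
  finally have var: "0 < expectation (\<lambda>\<omega>. Y \<omega> * Y \<omega>)" .
  have mean: "expectation Y = 0"
    unfolding Y_def using \<open>0 < h\<close> int1 centred[of h] centred[of "2 * h"] by simp
  have "\<not> (AE \<omega> in M. Y \<omega> = \<mu>)" for \<mu>
  proof
    assume const: "AE \<omega> in M. Y \<omega> = \<mu>"
    then have "expectation Y = expectation (\<lambda>_. \<mu>)"
      by (intro integral_cong_AE) auto
    then have "\<mu> = 0" using mean by (simp add: prob_space)
    then have "expectation (\<lambda>\<omega>. Y \<omega> * Y \<omega>) = expectation (\<lambda>_. 0)"
      using const by (intro integral_cong_AE) auto
    then show False using var by simp
  qed
  moreover have "gaussian_rv M Y"
  proof -
    have "\<forall>F c. finite F \<and> F \<subseteq> {0..} \<longrightarrow> gaussian_rv M (\<lambda>\<omega>. \<Sum>s\<in>F. c s * B s \<omega>)"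
      using fbm by (simp add: fractional_brownian_motion_def gaussian_process_on_def)
    then have "gaussian_rv M (\<lambda>\<omega>. \<Sum>s\<in>{h, 2 * h}. (if s = h then - 2 else 1) * B s \<omega>)"
      using \<open>0 < h\<close> by (elim allE[of _ "{h, 2 * h}"] allE[of _ "\<lambda>s. if s = h then - 2 else 1"] impE) auto
    then show ?thesis using \<open>0 < h\<close> by (simp add: Y_def[abs_def])
  qed
  ultimately show ?thesis
    unfolding gaussian_rv_def Y_def by blast
qed

text \<open>Independence excludes cancellation between components: the sum of the contrasts is again
  normal with positive variance, and a law with a density has no atom at 0.\<close>

lemma (in prob_space) AE_mixed_fbm_contrast_nonzero:
  fixes m :: nat
  assumes fbm: "\<And>r. r \<in> {1..m} \<Longrightarrow> fractional_brownian_motion M (H r) (B r)"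
    and H: "\<And>r. r \<in> {1..m} \<Longrightarrow> 0 < H r \<and> H r < 1"
    and indep: "independent_processes M {1..m} B"
    and "0 < h" "1 \<le> m"
  shows "AE \<omega> in M. (\<Sum>r=1..m. B r (2 * h) \<omega> - 2 * B r h \<omega>) \<noteq> 0"
proof -
  define Y where "Y r \<omega> = B r (2 * h) \<omega> - 2 * B r h \<omega>" for r \<omega>
  have "\<forall>r\<in>{1..m}. \<exists>\<mu> \<sigma>. 0 < \<sigma> \<and> distributed M lborel (Y r) (normal_density \<mu> \<sigma>)"
    unfolding Y_def[abs_def] using fbm H \<open>0 < h\<close> fbm_contrast_normal by metis
  then obtain \<mu> \<sigma> where normal: "\<And>r. r \<in> {1..m} \<Longrightarrow>
      0 < \<sigma> r \<and> distributed M lborel (Y r) (normal_density (\<mu> r) (\<sigma> r))"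
    by metis
  \<comment> \<open>Independence passes from paths to contrasts, which are measurable functions of
    two coordinates of the path.\<close>
  have "indep_vars (\<lambda>_. borel)
      (\<lambda>r \<omega>. (\<lambda>x. x (2 * h) - 2 * x h) (restrict (\<lambda>t. B r t \<omega>) {0..})) {1..m}"
    using indep[unfolded independent_processes_def]
  proof (rule indep_vars_compose2)
    show "(\<lambda>x. x (2 * h) - 2 * x h) \<in> borel_measurable (PiM {0..} (\<lambda>_. borel :: real measure))"
      using \<open>0 < h\<close> by (intro borel_measurable_diff borel_measurable_times measurable_component_singleton) auto
  qed
  then have "indep_vars (\<lambda>_. borel) Y {1..m}"
    using \<open>0 < h\<close> by (simp add: Y_def[abs_def])
  then have "distributed M lborel (\<lambda>\<omega>. \<Sum>r=1..m. Y r \<omega>)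
      (normal_density (\<Sum>r=1..m. \<mu> r) (sqrt (\<Sum>r=1..m. (\<sigma> r)\<^sup>2)))"
    using normal \<open>1 \<le> m\<close> by (intro sum_indep_normal) auto
  then have "AE \<omega> in M. (\<Sum>r=1..m. Y r \<omega>) \<noteq> 0"
    using AE_lborel_singleton[of "0::real"] by (subst distributed_AE2) auto
  then show ?thesis by (simp add: Y_def)
qed

theorem theorem3p1:
  fixes M :: "'a measure"
    and B :: "nat \<Rightarrow> real \<Rightarrow> 'a \<Rightarrow> real"
    and H :: "nat \<Rightarrow> real"
    and m :: nat
    and h \<theta> \<alpha> :: real
    and k :: "'n::finite \<Rightarrow> nat"
    and T :: "real ^ 'n"
    and \<Gamma> :: "real ^ 'n ^ 'n"
    and Z :: "'a \<Rightarrow> real ^ 'n"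
  defines "T \<equiv> obs_times k h"
    and "\<Gamma> \<equiv> Gamma_H m H T"
    and "Z \<equiv> obs_vector T (mixed_fbm_drift m B \<theta> \<alpha>)"
  assumes "prob_space M"
    and "h > 0"
    and "m \<ge> 1"
    and "\<And>r. r \<in> {1..m} \<Longrightarrow> 1 / 2 < H r \<and> H r < 1"
    and "\<And>r. r \<in> {1..m} \<Longrightarrow> fractional_brownian_motion M (H r) (B r)"
    and "independent_processes M {1..m} B"
    and "\<alpha> > 0"
    and "CARD('n) \<ge> 2"
    and "bij_betw k (UNIV :: 'n set) {1..CARD('n)}"
  shows "AE \<omega> in M. \<forall>p. is_arg_max (log_likelihood \<Gamma> T (Z \<omega>)) (\<lambda>q. q \<in> UNIV \<times> {0<..}) p
           \<longleftrightarrow> p = (theta_hat \<Gamma> T (Z \<omega>), alpha_sq_hat \<Gamma> T (Z \<omega>))"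
proof -
  interpret prob_space M by fact
  have range: "k ` UNIV = {1..CARD('n)}"
    using \<open>bij_betw k UNIV {1..CARD('n)}\<close> by (rule bij_betw_imp_surj_on)
  \<comment> \<open>Two observations supply the times \<open>h\<close> and \<open>2 * h\<close>; a
    single one would always be a multiple of \<open>T\<close>.\<close>
  have "1 \<in> k ` UNIV" "2 \<in> k ` UNIV"
    using \<open>CARD('n) \<ge> 2\<close> by (auto simp: range)
  then obtain i j where ij: "k i = 1" "k j = 2" by (metis imageE)
  have "T $ i \<noteq> 0" using ij \<open>h > 0\<close> by (simp add: T_def obs_times_def)
  then have "T \<noteq> 0" by auto
  have "AE \<omega> in M. (\<Sum>r=1..m. B r (2 * h) \<omega> - 2 * B r h \<omega>) \<noteq> 0"
    using assms by (intro AE_mixed_fbm_contrast_nonzero[where H = H]) force+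
  then show ?thesis
  proof eventually_elim
    case (elim \<omega>)
    \<comment> \<open>The drift cancels because \<open>T $ j = 2 * T $ i\<close>; for the same
      reason the contrast of every multiple of \<open>T\<close> is 0.\<close>
    have contrast: "Z \<omega> $ j - 2 * Z \<omega> $ i = \<alpha> * (\<Sum>r=1..m. B r (2 * h) \<omega> - 2 * B r h \<omega>)"
      by (simp add: Z_def obs_vector_def mixed_fbm_drift_def T_def obs_times_def ij
          sum_subtractf algebra_simps flip: sum_distrib_left)
    have "Z \<omega> \<noteq> c *\<^sub>R T" for c
    proof
      assume "Z \<omega> = c *\<^sub>R T"
      then have "Z \<omega> $ j - 2 * Z \<omega> $ i = 0"
        by (simp add: T_def obs_times_def ij)
      then show False using contrast elim \<open>\<alpha> > 0\<close> by simp
    qed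
    moreover have "0 < x \<bullet> (\<Gamma> *v x)" if "x \<noteq> 0" for x
      unfolding \<Gamma>_def T_def using assms that by (intro Gamma_H_pos) auto
    ultimately show ?case
      using \<open>T \<noteq> 0\<close> by (intro allI log_likelihood_unique_maximum) (auto simp: \<Gamma>_def transpose_Gamma_H)
  qed
qed

end
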